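(* Let $\omega:[0,1]\to\mathbb{R}_{+}$ be a strictly increasing modulus of continuity, and let $f\in\mathrm{Diff}^{\omega}_0[0,1]$ with $\gamma(f)=1$. Denote by $\omega^{-1}$ the inverse function of $\omega$. (1) If $\displaystyle\limsup_{x\to0}\frac{\omega(x)}{x\log\frac{e}{x}}<+\infty$, then there is a constant $C(f,\omega)$, not depending on $n$, such that $$\log\Gamma_n(f)\le C(f,\omega)\cdot\log\frac{n}{\omega^{-1}\left(\frac2n\right)}$$ for all $n\ge 2$ such that $\frac2n$ lies in the range of $\omega$. (2) If $\displaystyle\lim_{x\to0}\frac{\omega(x)}{x\log\frac{e}{x}}=0$, then $$\log\Gamma_n(f)\le(1+o(1))\cdot\log\frac{n}{\omega^{-1}\left(\frac2n\right)}\qquad\text{as } n\to\infty .$$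
   Context: $\mathrm{Diff}_0[0,1]$ is the group of all $C^1$-smooth diffeomorphisms of $[0,1]$ fixing the end points $0$ and $1$. For $f\in\mathrm{Diff}_0[0,1]$ and $n\in\mathbb{N}$, the growth sequence is $\Gamma_n(f)=\max\{\|(f^n)'\|_\infty,\|(f^{-n})'\|_\infty\}$, where $f^n$ is the $n$-th iterate and $\|\cdot\|_\infty$ is the uniform norm on $[0,1]$; and $\gamma(f)=\lim_{n\to\infty}\sqrt[n]{\Gamma_n(f)}$ (the limit exists by submultiplicativity). A modulus of continuity is a non-decreasing continuous function $\omega:[0,1]\to\mathbb{R}_+=[0,\infty)$ with $\omega(0)=0$ and $\omega(\delta_1+\delta_2)\le\omega(\delta_1)+\omega(\delta_2)$ whenever $\delta_1,\delta_2,\delta_1+\delta_2\in[0,1]$. For a modulus of continuity $\omega$, $\mathrm{Diff}^{\omega}_0[0,1]$ is the set of $f\in\mathrm{Diff}_0[0,1]$ for which there is a constant $K(f)$ with $\omega_{f'}(\delta)\le K(f)\,\omega(\delta)$ for all $\delta\in[0,1]$, where $\omega_{f'}(\delta)=\max_{|x-y|\le\delta}|f'(x)-f'(y)|$. The symbol $o(1)$ denotes a sequence (depending on $f$ and $\omega$) tending to $0$ as $n\to\infty$. *)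

theory Defs
  imports "HOL-Analysis.Analysis"
begin

text \<open>
  A map of \<open>[0,1]\<close> is represented by a function on \<open>real\<close> of which only the restriction to
  \<open>{0..1}\<close> matters: derivatives are taken within \<open>{0..1}\<close> (so they are one-sided at the end
  points), and inverses are taken on \<open>{0..1}\<close>.
\<close>

definition deriv01 :: "(real \<Rightarrow> real) \<Rightarrow> real \<Rightarrow> real" where
  "deriv01 f x = vector_derivative f (at x within {0..1})"

definition C1_on01 :: "(real \<Rightarrow> real) \<Rightarrow> bool" where
  "C1_on01 f \<longleftrightarrow> f differentiable_on {0..1} \<and> continuous_on {0..1} (deriv01 f)"

definition inverse01 :: "(real \<Rightarrow> real) \<Rightarrow> real \<Rightarrow> real" where
  "inverse01 f = inv_into {0..1} f"

definition Diff0 :: "(real \<Rightarrow> real) set" where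
  "Diff0 = {f. bij_betw f {0..1} {0..1} \<and> f 0 = 0 \<and> f 1 = 1 \<and>
               C1_on01 f \<and> C1_on01 (inverse01 f)}"

definition sup_norm01 :: "(real \<Rightarrow> real) \<Rightarrow> real" where
  "sup_norm01 g = (SUP x\<in>{0..1}. \<bar>g x\<bar>)"

definition growth_seq :: "(real \<Rightarrow> real) \<Rightarrow> nat \<Rightarrow> real" where
  "growth_seq f n =
     max (sup_norm01 (deriv01 (f ^^ n))) (sup_norm01 (deriv01 (inverse01 f ^^ n)))"

text \<open>For \<open>f \<in> Diff0\<close> the limit exists, since \<open>growth_seq f\<close> is submultiplicative.\<close>

definition growth_rate :: "(real \<Rightarrow> real) \<Rightarrow> real" where
  "growth_rate f = lim (\<lambda>n. root n (growth_seq f n))"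

definition modulus_of_continuity :: "(real \<Rightarrow> real) \<Rightarrow> bool" where
  "modulus_of_continuity \<omega> \<longleftrightarrow>
     (\<forall>x\<in>{0..1}. 0 \<le> \<omega> x) \<and> mono_on {0..1} \<omega> \<and> continuous_on {0..1} \<omega> \<and> \<omega> 0 = 0 \<and>
     (\<forall>\<delta>\<^sub>1\<in>{0..1}. \<forall>\<delta>\<^sub>2\<in>{0..1}. \<delta>\<^sub>1 + \<delta>\<^sub>2 \<in> {0..1} \<longrightarrow> \<omega> (\<delta>\<^sub>1 + \<delta>\<^sub>2) \<le> \<omega> \<delta>\<^sub>1 + \<omega> \<delta>\<^sub>2)"

text \<open>For continuous \<open>g\<close> and \<open>\<delta> \<ge> 0\<close> the supremum is a maximum, by compactness.\<close>

definition oscillation01 :: "(real \<Rightarrow> real) \<Rightarrow> real \<Rightarrow> real" where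
  "oscillation01 g \<delta> =
     (SUP (x, y)\<in>{(x, y). x \<in> {0..1} \<and> y \<in> {0..1} \<and> \<bar>x - y\<bar> \<le> \<delta>}. \<bar>g x - g y\<bar>)"

definition Diff0_mod :: "(real \<Rightarrow> real) \<Rightarrow> (real \<Rightarrow> real) set" where
  "Diff0_mod \<omega> =
     {f \<in> Diff0. \<exists>K. \<forall>\<delta>\<in>{0..1}. oscillation01 (deriv01 f) \<delta> \<le> K * \<omega> \<delta>}"

end

theory Submission
  imports Defs
begin

text \<open>
  Put \<open>F = ln f'\<close> and let \<open>S\<^sub>n = ln (f\<^sup>n)'\<close>, which by the chain rule is the sum of \<open>F\<close> along the first
  \<open>n\<close> points of the orbit. Then \<open>ln \<Gamma>\<^sub>n = max (a\<^sub>n) (b\<^sub>n)\<close>, where \<open>a\<^sub>n = max S\<^sub>n\<close> and \<open>b\<^sub>n = max (- S\<^sub>n)\<close>. It is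
  enough to bound both by a multiple of \<open>ln n\<close>, because \<open>\<omega>\<^sup>-\<^sup>1 \<le> 1\<close> gives
  \<open>ln (n / \<omega>\<^sup>-\<^sup>1 (2/n)) \<ge> ln n\<close>, while the linear lower bound \<open>\<omega> x \<ge> c x\<close> that subadditivity forces
  improves this to \<open>2 ln n - O(1)\<close>, so that for the second claim \<open>ln \<Gamma>\<^sub>n \<le> (2 + o(1)) ln n\<close> is needed.

  The mechanism is a growth gap. Comparing the maximum of \<open>S\<^sub>k\<close>, attained at \<open>x = f u\<close>, with the values
  of \<open>S\<^sub>k\<^sub>+\<^sub>1\<close> at \<open>u\<close> and of \<open>S\<^sub>k\<^sub>-\<^sub>1\<close> at \<open>f x\<close> gives
  \<open>2 a\<^sub>k - a\<^sub>k\<^sub>-\<^sub>1 - a\<^sub>k\<^sub>+\<^sub>1 \<le> F (f u) - F u\<close>. The interval between \<open>u\<close> and \<open>f u\<close> is a fundamental interval of \<open>f\<close>: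
  its first \<open>k\<close> images have disjoint interiors, hence total length at most \<open>1\<close>. If \<open>F\<close> has modulus of continuity
  \<open>\<eta> t ln (e/t) + M t\<close>, then the distortion of \<open>f\<^sup>k\<close> on this interval is bounded by an entropy, which is at
  most \<open>\<eta> ln k + O(1)\<close>. As the \<open>k\<close>-th image also has length at most \<open>1\<close>, this forces
  \<open>\<bar>f u - u\<bar> \<le> O(1) k\<^sup>\<eta> e\<^sup>-\<^sup>a\<close> with \<open>a = a\<^sub>k\<close>: a large derivative makes the fundamental interval short. So \<open>a\<close> is
  almost convex, with a defect of about \<open>k\<^sup>\<eta> e\<^sup>-\<^sup>a\<close>, up to a factor \<open>e\<^sup>\<delta>\<^sup>a\<close> with \<open>\<delta>\<close> as small as desired.
  The same holds for \<open>b\<close>, with the \<open>k\<close>-th image of the fundamental interval in place of the interval itself.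

  A sequence with such a defect that once exceeds the barrier \<open>(2 + \<eta>) / (1 - \<delta>) ln (k + 1) + B\<close> grows at least
  linearly from then on (\<open>sublinear_almost_convex_le_ln\<close>), whereas \<open>\<gamma>(f) = 1\<close> makes \<open>ln \<Gamma>\<^sub>n\<close>, and so \<open>a\<close> and \<open>b\<close>, grow
  slower than any linear function. In the first claim one \<open>\<eta>\<close> is available; in the second one \<open>\<eta>\<close> and \<open>\<delta>\<close> can be taken
  arbitrarily small, so the factor tends to \<open>2\<close>.
\<close>

section \<open>Subadditive and almost convex sequences\<close>

text \<open>
  Fekete's lemma. It is what makes the growth rate an actual limit; the value of \<open>lim\<close> would
  otherwise carry no information.
\<close>

lemma subadditive_convergent_average:
  fixes u :: "nat \<Rightarrow> real"
  assumes sub: "\<And>m n. u (m + n) \<le> u m + u n" and nonneg: "\<And>n. 0 \<le> u n"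
  shows "convergent (\<lambda>n. u n / real n)"
proof -
  define l where "l = (INF n\<in>{1..}. u n / real n)"
  have bdd: "bdd_below ((\<lambda>n. u n / real n) ` {1..})"
    using nonneg by (intro bdd_belowI[of _ 0]) auto
  have lower: "l \<le> u n / real n" if "n \<ge> 1" for n
    unfolding l_def using bdd that by (intro cINF_lower) auto
  have mult: "u (q * m) \<le> real q * u m + u 0" for q m
  proof (induction q)
    case (Suc q)
    then show ?case using sub[of m "q * m"] by (simp add: algebra_simps)
  qed simp
  have "(\<lambda>n. u n / real n) \<longlonglongrightarrow> l"
  proof (rule LIMSEQ_I)
    fix r :: real assume r: "0 < r"
    have "\<exists>m\<in>{1..}. u m / real m < l + r / 2"
      using r bdd cINF_less_iff[of "{1::nat..}" "\<lambda>n. u n / real n" "l + r/2"]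
      unfolding l_def by auto
    then obtain m where m: "m \<ge> 1" "u m / real m < l + r / 2" by auto
    define T where "T = (\<Sum>i<m. u i) + u 0"
    have rem: "u (n mod m) + u 0 \<le> T" for n
      unfolding T_def using m(1) nonneg by (auto intro!: member_le_sum)
    have "\<forall>\<^sub>F n in sequentially. T / real n < r / 2"
      using r by (intro order_tendstoD(2)[OF lim_const_over_n]) auto
    then obtain N where N: "\<And>n. n \<ge> N \<Longrightarrow> T / real n < r / 2"
      by (auto simp: eventually_sequentially)
    have "norm (u n / real n - l) < r" if n: "n \<ge> max N 1" for n
    proof -
      have "u n \<le> u (n div m * m) + u (n mod m)"
        using sub[of "n div m * m" "n mod m"] by simp
      also have "\<dots> \<le> real (n div m) * u m + T"
        using mult[of "n div m" m] rem[of n] by linarith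
      also have "real (n div m) * u m \<le> real n * (u m / real m)"
      proof -
        have "real (n div m) \<le> real n / real m" by (rule of_nat_div_le_of_nat)
        from mult_right_mono[OF this nonneg[of m]] show ?thesis by simp
      qed
      finally have "u n / real n \<le> u m / real m + T / real n"
        using n by (simp add: field_simps)
      moreover have "T / real n < r / 2" using N n by simp
      moreover have "l \<le> u n / real n" using lower n by simp
      ultimately show ?thesis using m(2) unfolding real_norm_def by linarith
    qed
    then show "\<exists>no. \<forall>n\<ge>no. norm (u n / real n - l) < r" by blast
  qed
  then show ?thesis by (rule convergentI)
qed

lemma ln_second_difference_ge:
  fixes x :: real
  assumes "x > 1"
  shows "1 / x\<^sup>2 \<le> 2 * ln x - ln (x - 1) - ln (x + 1)"
proof -
  have "ln ((x - 1) * (x + 1) / x\<^sup>2) \<le> (x - 1) * (x + 1) / x\<^sup>2 - 1"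
    using assms by (intro ln_le_minus_one) auto
  also have "\<dots> = - (1 / x\<^sup>2)"
    using assms by (simp add: field_simps power2_eq_square)
  also have "ln ((x - 1) * (x + 1) / x\<^sup>2) = ln (x - 1) + ln (x + 1) - 2 * ln x"
    using assms by (subst ln_div) (auto simp: ln_mult ln_realpow)
  finally show ?thesis by linarith
qed

text \<open>
  The growth gap. The barrier \<open>b k = q ln (k + 1) + B\<close> has a concavity defect of at least
  \<open>q / (k + 2)\<^sup>2\<close> at \<open>k + 1\<close>, and \<open>q = (p + 2) / l\<close> is exactly the factor for which
  \<open>k\<^sup>p e\<^sup>-\<^sup>l\<^sup>b\<close> decays like \<open>1 / k\<^sup>2\<close>. So wherever \<open>a\<close> lies above \<open>b\<close> the difference \<open>a - b\<close> is convex: after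
  its first positive value it never stops increasing at the same rate at least, and \<open>a\<close> is not
  sublinear.
\<close>
lemma sublinear_almost_convex_le_ln:
  fixes a :: "nat \<Rightarrow> real"
  assumes p: "p \<ge> 0" and l: "l > 0" and M: "M \<ge> 0" and a0: "a 0 \<le> 0"
    and step: "\<And>k. 2 * a (Suc k) - a k - a (Suc (Suc k))
                 \<le> M * real (Suc k) powr p * exp (- l * a (Suc k))"
    and sublinear: "\<And>s. s > 0 \<Longrightarrow> \<forall>\<^sub>F k in sequentially. a k \<le> s * real k"
  shows "\<exists>B\<ge>0. \<forall>k. a k \<le> (p + 2) / l * ln (real k + 1) + B"
proof -
  define q where "q = (p + 2) / l"
  define B where "B = M / q / l"
  define b where "b k = q * ln (real k + 1) + B" for k :: nat
  define d where "d k = a k - b k" for k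
  have q: "q > 0" and B: "B \<ge> 0" using p l M by (auto simp: q_def B_def)
  \<comment> \<open>The constant \<open>B\<close> makes the defect of \<open>a\<close> on the barrier at most that of the barrier;
    \<open>z \<le> exp z\<close> at \<open>z = M / q\<close> is enough.\<close>
  have MB: "M * exp (- l * B) \<le> q"
  proof -
    have "M / q \<le> exp (M / q)" using exp_ge_add_one_self[of "M / q"] by linarith
    then show ?thesis using l q by (simp add: B_def exp_minus field_simps)
  qed
  have barrier: "M * real (Suc k) powr p * exp (- l * b (Suc k))
                   \<le> 2 * b (Suc k) - b k - b (Suc (Suc k))" for k
  proof -
    define x where "x = real k + 2"
    have x: "x > 1" by (simp add: x_def)
    have "- l * b (Suc k) = - l * B + ln x * (- (p + 2))"
      using l by (simp add: b_def q_def x_def field_simps)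
    then have "exp (- l * b (Suc k)) = exp (- l * B) * x powr (- (p + 2))"
      using x by (simp only: exp_add) (simp add: powr_def mult.commute)
    moreover have "real (Suc k) powr p \<le> x powr p"
      using p by (intro powr_mono2) (auto simp: x_def)
    ultimately have "M * real (Suc k) powr p * exp (- l * b (Suc k))
        \<le> M * x powr p * (exp (- l * B) * x powr (- (p + 2)))"
      using M by (simp add: mult_left_mono mult_right_mono)
    also have "\<dots> = M * exp (- l * B) * (x powr p * x powr (- (p + 2)))" by simp
    also have "x powr p * x powr (- (p + 2)) = 1 / x\<^sup>2"
      using x by (simp flip: powr_add add: powr_minus divide_inverse)
    also have "M * exp (- l * B) * (1 / x\<^sup>2) \<le> q * (1 / x\<^sup>2)"
      using MB by (intro mult_right_mono) auto
    also have "\<dots> \<le> q * (2 * ln x - ln (x - 1) - ln (x + 1))"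
      using q ln_second_difference_ge[OF x] by (intro mult_left_mono) auto
    also have "\<dots> = 2 * b (Suc k) - b k - b (Suc (Suc k))"
      by (simp add: b_def x_def algebra_simps)
    finally show ?thesis .
  qed
  have convex: "d (Suc k) - d k \<le> d (Suc (Suc k)) - d (Suc k)" if "d (Suc k) > 0" for k
  proof -
    have "exp (- l * a (Suc k)) \<le> exp (- l * b (Suc k))" using that l by (simp add: d_def)
    then have "M * real (Suc k) powr p * exp (- l * a (Suc k))
        \<le> M * real (Suc k) powr p * exp (- l * b (Suc k))"
      using M by (intro mult_left_mono) auto
    then show ?thesis using step[of k] barrier[of k] by (simp add: d_def)
  qed
  have "d k \<le> 0" for k
  proof (rule ccontr)
    assume "\<not> d k \<le> 0"
    then have ex: "\<exists>k. d k > 0" by (auto simp: not_le)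
    define k0 where "k0 = (LEAST k. d k > 0)"
    have k0: "d k0 > 0" unfolding k0_def using ex by (rule LeastI_ex)
    have "d 0 \<le> 0" using a0 B by (simp add: d_def b_def)
    with k0 obtain j where j: "k0 = Suc j" by (cases k0) auto
    have "d j \<le> 0" using not_less_Least[of j "\<lambda>k. d k > 0"] j by (simp add: k0_def not_less)
    define s where "s = d (Suc j) - d j"
    have s: "s > 0" using \<open>d j \<le> 0\<close> k0 j by (simp add: s_def)
    have incr: "d (Suc j + i) > 0 \<and> s \<le> d (Suc j + i) - d (j + i)" for i
    proof (induction i)
      case 0 then show ?case using k0 j by (simp add: s_def)
    next
      case (Suc i)
      then show ?case using convex[of "j + i"] s by simp
    qed
    have lin: "s * real i \<le> d (Suc j + i)" for i
    proof (induction i)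
      case 0 then show ?case using incr[of 0] by simp
    next
      case (Suc i) then show ?case using incr[of "Suc i"] by (simp add: algebra_simps)
    qed
    have b_nonneg: "b k \<ge> 0" for k using q B by (simp add: b_def)
    from sublinear[of "s / 2"] s obtain N where N: "\<And>k. k \<ge> N \<Longrightarrow> a k \<le> s / 2 * real k"
      by (auto simp: eventually_sequentially)
    define i where "i = N + Suc (Suc j)"
    have "s * real i \<le> a (Suc j + i)" using lin[of i] b_nonneg[of "Suc j + i"] by (simp add: d_def)
    also have "\<dots> \<le> s / 2 * real (Suc j + i)" by (rule N) (simp add: i_def)
    finally have "s * real i \<le> s * real (Suc j)" by (simp add: field_simps)
    then show False using s by (simp add: i_def)
  qed
  then show ?thesis using B by (intro exI[of _ B]) (auto simp: d_def b_def q_def)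
qed

section \<open>The modulus of continuity t log (e/t)\<close>

text \<open>
  At \<open>t = 0\<close> the value is \<open>0\<close>, which is also the limit.
\<close>
definition log_modulus :: "real \<Rightarrow> real \<Rightarrow> real \<Rightarrow> real" where
  "log_modulus \<eta> M t = \<eta> * (t * ln (exp 1 / t)) + M * t"

text \<open>
  The tangent inequality for the concave function \<open>t ln (e/t)\<close> at \<open>t = 1 / k\<close>. Summed over a
  partition of \<open>[0,1]\<close> into \<open>k\<close> pieces, it says that the entropy is largest for equal pieces.
\<close>
lemma entropy_term_le:
  fixes t :: real
  assumes "0 \<le> t" "0 < k"
  shows "t * ln (exp 1 / t) \<le> t * ln k + 1 / k"
proof (cases "t = 0")
  case False
  with assms have t: "t > 0" by simp
  have "ln (1 / (k * t)) \<le> 1 / (k * t) - 1"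
    using t assms by (intro ln_le_minus_one) auto
  then have "ln (exp 1 / t) \<le> ln k + 1 / (k * t)"
    using t assms by (simp add: ln_div ln_mult)
  then have "t * ln (exp 1 / t) \<le> t * (ln k + 1 / (k * t))"
    using t by (intro mult_left_mono) auto
  then show ?thesis using t assms by (simp add: distrib_left)
qed (use assms in auto)

text \<open>
  This trades the logarithm for an arbitrarily small power, which puts the defect in the form
  required by the growth gap.
\<close>
lemma log_modulus_le_powr:
  assumes "0 \<le> \<eta>" "0 \<le> M" "0 < \<delta>" "\<delta> \<le> 1" "0 \<le> t" "t \<le> 1"
  shows "log_modulus \<eta> M t \<le> (\<eta> / \<delta> + M) * t powr (1 - \<delta>)"
proof (cases "t = 0")
  case False
  with assms have t: "t > 0" by simp
  have "\<delta> * ln (1 / t) = ln (t powr (- \<delta>))" using t by (simp add: ln_powr ln_div)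
  also have "\<dots> \<le> t powr (- \<delta>) - 1" using t by (intro ln_le_minus_one) auto
  finally have "\<delta> * ln (exp 1 / t) \<le> t powr (- \<delta>)"
    using assms t by (simp add: ln_div algebra_simps)
  then have "t * ln (exp 1 / t) \<le> t * (t powr (- \<delta>) / \<delta>)"
    using assms by (intro mult_left_mono) (auto simp: field_simps)
  also have "\<dots> = t powr (1 - \<delta>) / \<delta>"
    using t by (simp add: powr_diff powr_minus divide_inverse)
  finally have 1: "\<eta> * (t * ln (exp 1 / t)) \<le> \<eta> * (t powr (1 - \<delta>) / \<delta>)"
    using assms by (intro mult_left_mono)
  have "t powr 1 \<le> t powr (1 - \<delta>)" using assms by (intro powr_mono') auto
  then have "M * t \<le> M * t powr (1 - \<delta>)" using assms t by (intro mult_left_mono) auto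
  with 1 show ?thesis by (simp add: log_modulus_def algebra_simps)
qed (simp add: log_modulus_def)

lemma sum_log_modulus_le:
  assumes "0 \<le> \<eta>" "0 \<le> M" "0 < k" "\<And>j. j < k \<Longrightarrow> 0 \<le> t j" "(\<Sum>j<k. t j) \<le> 1"
  shows "(\<Sum>j<k. log_modulus \<eta> M (t j)) \<le> \<eta> * (ln (real k) + 1) + M"
proof -
  have "(\<Sum>j<k. t j * ln (exp 1 / t j)) \<le> (\<Sum>j<k. t j * ln (real k) + 1 / real k)"
    using assms by (intro sum_mono entropy_term_le) auto
  also have "\<dots> = (\<Sum>j<k. t j) * ln (real k) + 1"
    using assms by (simp add: sum.distrib sum_distrib_right)
  also have "\<dots> \<le> 1 * ln (real k) + 1"
    using assms by (intro add_right_mono mult_right_mono) auto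
  finally have "\<eta> * (\<Sum>j<k. t j * ln (exp 1 / t j)) \<le> \<eta> * (ln (real k) + 1)"
    using assms by (intro mult_left_mono) auto
  moreover have "M * (\<Sum>j<k. t j) \<le> M * 1" using assms by (intro mult_left_mono) auto
  ultimately show ?thesis
    by (simp add: log_modulus_def sum.distrib sum_distrib_left)
qed


section \<open>Extremal derivatives of iterates\<close>

text \<open>
  Writing the derivative as \<open>exp (F x)\<close> makes it positive and turns the chain rule into addition.
\<close>
locale interval_dynamics =
  fixes f F :: "real \<Rightarrow> real"
  assumes onto: "f ` {0..1} = {0..1}"
    and deriv: "\<And>x. x \<in> {0..1} \<Longrightarrow> (f has_real_derivative exp (F x)) (at x within {0..1})"
    and cont: "continuous_on {0..1} F"
begin

text \<open>This is \<open>ln (f\<^sup>n)'\<close>, see \<open>iterate_deriv\<close>.\<close>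
definition birkhoff :: "nat \<Rightarrow> real \<Rightarrow> real" where
  "birkhoff n x = (\<Sum>j<n. F ((f ^^ j) x))"

text \<open>
  The sign \<open>\<sigma> = 1\<close> gives the logarithm of the largest derivative of \<open>f\<^sup>n\<close>, and \<open>\<sigma> = -1\<close> that of the
  largest derivative of \<open>f\<^sup>-\<^sup>n\<close>, so that both halves of the growth sequence are treated at once.
\<close>
definition extremum :: "real \<Rightarrow> nat \<Rightarrow> real" where
  "extremum \<sigma> n = (SUP x\<in>{0..1}. \<sigma> * birkhoff n x)"

lemma iterate_onto: "(f ^^ n) ` {0..1} = {0..1}"
  by (induction n) (simp_all add: onto flip: image_image)

lemma iterate_mem: "x \<in> {0..1} \<Longrightarrow> (f ^^ n) x \<in> {0..1}"
  using iterate_onto[of n] by blast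

lemma maps: "x \<in> {0..1} \<Longrightarrow> f x \<in> {0..1}"
  using onto by blast

lemma birkhoff_add: "birkhoff (m + n) x = birkhoff m x + birkhoff n ((f ^^ m) x)"
proof (induction n)
  case (Suc n)
  have "(f ^^ (m + n)) x = (f ^^ n) ((f ^^ m) x)"
    by (subst add.commute) (simp add: funpow_add)
  with Suc show ?case by (simp add: birkhoff_def)
qed (simp add: birkhoff_def)

lemma iterate_deriv:
  assumes "x \<in> {0..1}"
  shows "((f ^^ n) has_real_derivative exp (birkhoff n x)) (at x within {0..1})"
proof (induction n)
  case 0
  then show ?case by (simp add: birkhoff_def id_def)
next
  case (Suc n)
  have "(f has_real_derivative exp (F ((f ^^ n) x))) (at ((f ^^ n) x) within (f ^^ n) ` {0..1})"
    using deriv[OF iterate_mem[OF assms]] by (simp add: iterate_onto)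
  from DERIV_image_chain[OF this Suc]
  show ?case by (simp add: birkhoff_def exp_add mult.commute comp_def)
qed

lemma iterate_mean_value:
  assumes "u \<in> {0..1}" "v \<in> {0..1}" "u < v"
  obtains \<xi> where "u < \<xi>" "\<xi> < v" "(f ^^ n) v - (f ^^ n) u = exp (birkhoff n \<xi>) * (v - u)"
proof -
  have "\<exists>\<xi>\<in>{u<..<v}. (f ^^ n) v - (f ^^ n) u = exp (birkhoff n \<xi>) * (v - u)"
  proof (rule mvt_simple[OF assms(3)])
    fix x assume "u \<le> x" "x \<le> v"
    with assms have "((f ^^ n) has_real_derivative exp (birkhoff n x)) (at x within {u..v})"
      by (intro DERIV_subset[OF iterate_deriv]) auto
    then show "((f ^^ n) has_derivative (*) (exp (birkhoff n x))) (at x within {u..v})"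
      by (simp add: has_field_derivative_def)
  qed
  then show ?thesis using that by auto
qed

lemma iterate_mono:
  assumes "u \<in> {0..1}" "v \<in> {0..1}" "u \<le> v"
  shows "(f ^^ n) u \<le> (f ^^ n) v"
proof (cases "u = v")
  case False
  then obtain \<xi> where "(f ^^ n) v - (f ^^ n) u = exp (birkhoff n \<xi>) * (v - u)"
    using iterate_mean_value[of u v n] assms by (auto simp: less_le)
  moreover have "\<dots> \<ge> 0" using assms by simp
  ultimately show ?thesis by linarith
qed simp

lemma birkhoff_continuous: "continuous_on {0..1} (birkhoff n)"
proof -
  have "continuous_on {0..1} (\<lambda>x. F ((f ^^ j) x))" for j
  proof (rule continuous_on_compose2[OF cont])
    show "continuous_on {0..1} (f ^^ j)"
      using iterate_deriv by (meson DERIV_continuous_on)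
  qed (simp add: iterate_onto)
  then show ?thesis unfolding birkhoff_def by (intro continuous_on_sum)
qed

lemma extremum_attained:
  obtains x where "x \<in> {0..1}" "extremum \<sigma> n = \<sigma> * birkhoff n x"
    "\<And>y. y \<in> {0..1} \<Longrightarrow> \<sigma> * birkhoff n y \<le> extremum \<sigma> n"
proof -
  have "continuous_on {0..1} (\<lambda>x. \<sigma> * birkhoff n x)"
    by (intro continuous_intros birkhoff_continuous)
  from continuous_attains_sup[OF _ _ this]
  obtain x where x: "x \<in> {0..1}" "\<And>y. y \<in> {0..1} \<Longrightarrow> \<sigma> * birkhoff n y \<le> \<sigma> * birkhoff n x"
    by auto
  have "extremum \<sigma> n = \<sigma> * birkhoff n x"
    unfolding extremum_def using x by (intro cSup_eq_maximum) auto
  with x that show ?thesis by simp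
qed

lemma extremum_upper: "x \<in> {0..1} \<Longrightarrow> \<sigma> * birkhoff n x \<le> extremum \<sigma> n"
  by (meson extremum_attained)

lemma extremum_0: "extremum \<sigma> 0 = 0"
  by (simp add: extremum_def birkhoff_def)

lemma extremum_subadditive: "extremum \<sigma> (m + n) \<le> extremum \<sigma> m + extremum \<sigma> n"
proof -
  obtain x where x: "x \<in> {0..1}" "extremum \<sigma> (m + n) = \<sigma> * birkhoff (m + n) x"
    by (meson extremum_attained)
  then show ?thesis
    using extremum_upper[OF x(1), of \<sigma> m] extremum_upper[OF iterate_mem[OF x(1), of m], of \<sigma> n]
    by (simp add: birkhoff_add distrib_left)
qed

lemma iterate_inverse_deriv:
  assumes inv: "\<And>x. x \<in> {0..1} \<Longrightarrow> g (f x) = x"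
    and g: "\<And>x. x \<in> {0..1} \<Longrightarrow> (g has_real_derivative exp (- F x)) (at (f x) within {0..1})"
    and x: "x \<in> {0..1}"
  shows "((g ^^ n) has_real_derivative exp (- birkhoff n x)) (at ((f ^^ n) x) within {0..1})"
proof (induction n)
  case 0
  then show ?case by (simp add: birkhoff_def id_def)
next
  case (Suc n)
  have mem: "(f ^^ n) x \<in> {0..1}" using iterate_mem[OF x] .
  have "g ` {0..1} = g ` f ` {0..1}" by (simp add: onto)
  also have "\<dots> = {0..1}" using inv by (auto simp: image_image)
  finally have "((g ^^ n) has_real_derivative exp (- birkhoff n x))
      (at (g ((f ^^ Suc n) x)) within g ` {0..1})"
    using Suc inv[OF mem] by simp
  moreover have "(g has_real_derivative exp (- F ((f ^^ n) x))) (at ((f ^^ Suc n) x) within {0..1})"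
    using g[OF mem] by simp
  ultimately have "(g ^^ n \<circ> g has_real_derivative exp (- birkhoff n x) * exp (- F ((f ^^ n) x)))
      (at ((f ^^ Suc n) x) within {0..1})"
    by (rule DERIV_image_chain)
  moreover have "g ^^ n \<circ> g = g ^^ Suc n" by (simp only: funpow_Suc_right)
  moreover have "exp (- birkhoff n x) * exp (- F ((f ^^ n) x)) = exp (- birkhoff (Suc n) x)"
    by (simp add: birkhoff_def exp_diff exp_minus divide_inverse flip: exp_add)
  ultimately show ?case by metis
qed

end

section \<open>Distortion on fundamental intervals\<close>

text \<open>
  The bound by the modulus at every \<open>t \<ge> \<bar>x - y\<bar>\<close> is the form in which an oscillation bound provides
  it, and in which it is used: \<open>t\<close> will be the length of an interval containing \<open>x\<close> and \<open>y\<close>.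
\<close>
locale interval_dynamics_log_modulus = interval_dynamics +
  fixes \<eta> M :: real
  assumes eta_nonneg: "0 \<le> \<eta>" and M_nonneg: "0 \<le> M"
    and modulus: "\<And>x y t. \<lbrakk>x \<in> {0..1}; y \<in> {0..1}; \<bar>x - y\<bar> \<le> t; t \<le> 1\<rbrakk>
                    \<Longrightarrow> \<bar>F x - F y\<bar> \<le> log_modulus \<eta> M t"
begin

text \<open>
  Orbits of an increasing map are monotone, so the displacements along an orbit all have one sign
  and telescope.
\<close>
lemma fundamental_lengths_sum_le:
  assumes u: "u \<in> {0..1}"
  shows "(\<Sum>j<k. \<bar>(f ^^ j) (f u) - (f ^^ j) u\<bar>) \<le> 1"
proof -
  have telescope: "(\<Sum>j<k. (f ^^ j) (f u) - (f ^^ j) u) = (f ^^ k) u - u"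
    using sum_lessThan_telescope[of "\<lambda>j. (f ^^ j) u" k] by (simp add: funpow_swap1)
  have bound: "\<bar>(f ^^ k) u - u\<bar> \<le> 1" using iterate_mem[OF u, of k] u by auto
  show ?thesis
  proof (cases "u \<le> f u")
    case True
    then have "\<bar>(f ^^ j) (f u) - (f ^^ j) u\<bar> = (f ^^ j) (f u) - (f ^^ j) u" for j
      using iterate_mono[OF u maps[OF u], of j] by simp
    then show ?thesis using telescope bound by simp
  next
    case False
    then have "\<bar>(f ^^ j) (f u) - (f ^^ j) u\<bar> = - ((f ^^ j) (f u) - (f ^^ j) u)" for j
      using iterate_mono[OF maps[OF u] u, of j] by simp
    then show ?thesis using telescope bound by (simp only: sum_negf)
  qed
qed

text \<open>
  The images of \<open>x\<close> and \<open>y\<close> stay in the images of the fundamental interval, whose lengths add up to at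
  most \<open>1\<close>. The sum of the oscillations of \<open>F\<close> is then an entropy.
\<close>
lemma distortion:
  assumes u: "u \<in> {0..1}" and xy: "x \<in> closed_segment u (f u)" "y \<in> closed_segment u (f u)"
    and k: "0 < k"
  shows "\<bar>birkhoff k x - birkhoff k y\<bar> \<le> \<eta> * (ln (real k) + 1) + M"
proof -
  define t where "t j = \<bar>(f ^^ j) (f u) - (f ^^ j) u\<bar>" for j
  have fu: "f u \<in> {0..1}" using maps[OF u] .
  have seg: "closed_segment u (f u) \<subseteq> {0..1}"
    using u fu by (intro closed_segment_subset) auto
  have image: "(f ^^ j) z \<in> closed_segment ((f ^^ j) u) ((f ^^ j) (f u))"
    if "z \<in> closed_segment u (f u)" for z j
  proof (cases "u \<le> f u")
    case True
    then have "u \<le> z" "z \<le> f u" "z \<in> {0..1}" using that seg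
      by (auto simp: closed_segment_eq_real_ivl)
    then show ?thesis
      using iterate_mono[OF u, of z j] iterate_mono[OF _ fu, of z j]
      by (auto simp: closed_segment_eq_real_ivl)
  next
    case False
    then have "z \<le> u" "f u \<le> z" "z \<in> {0..1}" using that seg
      by (auto simp: closed_segment_eq_real_ivl)
    then show ?thesis
      using iterate_mono[OF _ u, of z j] iterate_mono[OF fu, of z j]
      by (auto simp: closed_segment_eq_real_ivl)
  qed
  have "\<bar>F ((f ^^ j) x) - F ((f ^^ j) y)\<bar> \<le> log_modulus \<eta> M (t j)" for j
  proof (rule modulus)
    show "(f ^^ j) x \<in> {0..1}" "(f ^^ j) y \<in> {0..1}" using xy seg iterate_mem by blast+
    show "t j \<le> 1" using iterate_mem[OF u, of j] iterate_mem[OF fu, of j] by (auto simp: t_def)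
    show "\<bar>(f ^^ j) x - (f ^^ j) y\<bar> \<le> t j"
      using image[OF xy(1), of j] image[OF xy(2), of j]
      by (auto simp: t_def closed_segment_eq_real_ivl split: if_splits)
  qed
  then have "\<bar>birkhoff k x - birkhoff k y\<bar> \<le> (\<Sum>j<k. log_modulus \<eta> M (t j))"
    unfolding birkhoff_def sum_subtractf[symmetric] by (intro order.trans[OF sum_abs] sum_mono)
  also have "\<dots> \<le> \<eta> * (ln (real k) + 1) + M"
    using fundamental_lengths_sum_le[OF u, of k] k eta_nonneg M_nonneg
    by (intro sum_log_modulus_le) (auto simp: t_def)
  finally show ?thesis .
qed

text \<open>
  By the mean value theorem, the fundamental interval and its \<open>k\<close>-th image have lengths with
  quotient \<open>(f\<^sup>k)'(\<xi>)\<close> for some \<open>\<xi>\<close>, which equals \<open>(f\<^sup>k)'(f u)\<close> up to distortion. Neither length exceeds \<open>1\<close>,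
  so the length that is contracted from the other one is at most the contraction factor, up to
  distortion: the first bound is of use if \<open>f\<^sup>k\<close> expands at \<open>f u\<close>, the second if it contracts there.
\<close>
lemma fundamental_length_comparison:
  assumes u: "u \<in> {0..1}" and k: "0 < k"
  shows "\<bar>f u - u\<bar> \<le> exp (\<eta> * (ln (real k) + 1) + M - birkhoff k (f u))"
    and "\<bar>(f ^^ k) (f u) - (f ^^ k) u\<bar> \<le> exp (\<eta> * (ln (real k) + 1) + M + birkhoff k (f u))"
proof -
  define D where "D = \<eta> * (ln (real k) + 1) + M"
  have fu: "f u \<in> {0..1}" using maps[OF u] .
  have "\<exists>\<xi>\<in>closed_segment u (f u).
          \<bar>(f ^^ k) (f u) - (f ^^ k) u\<bar> = exp (birkhoff k \<xi>) * \<bar>f u - u\<bar>"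
  proof (cases u "f u" rule: linorder_cases)
    case less
    obtain \<xi> where \<xi>: "u < \<xi>" "\<xi> < f u"
      "(f ^^ k) (f u) - (f ^^ k) u = exp (birkhoff k \<xi>) * (f u - u)"
      using iterate_mean_value[OF u fu less] by blast
    then show ?thesis
      by (intro bexI[of _ \<xi>]) (auto simp: abs_mult closed_segment_eq_real_ivl)
  next
    case greater
    obtain \<xi> where \<xi>: "f u < \<xi>" "\<xi> < u"
      "(f ^^ k) u - (f ^^ k) (f u) = exp (birkhoff k \<xi>) * (u - f u)"
      using iterate_mean_value[OF fu u greater] by blast
    then show ?thesis
      by (intro bexI[of _ \<xi>])
        (auto simp: abs_mult abs_minus_commute closed_segment_eq_real_ivl)
  qed auto
  then obtain \<xi> where \<xi>: "\<xi> \<in> closed_segment u (f u)"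
    "\<bar>(f ^^ k) (f u) - (f ^^ k) u\<bar> = exp (birkhoff k \<xi>) * \<bar>f u - u\<bar>" by blast
  have dist: "\<bar>birkhoff k \<xi> - birkhoff k (f u)\<bar> \<le> D"
    unfolding D_def by (rule distortion[OF u \<xi>(1) _ k]) simp
  have le1: "\<bar>f u - u\<bar> \<le> 1" "\<bar>(f ^^ k) (f u) - (f ^^ k) u\<bar> \<le> 1"
    using u fu iterate_mem[OF u, of k] iterate_mem[OF fu, of k] by auto
  have "\<bar>f u - u\<bar> = exp (- birkhoff k \<xi>) * \<bar>(f ^^ k) (f u) - (f ^^ k) u\<bar>"
    by (simp add: \<xi>(2) exp_minus)
  also have "\<dots> \<le> exp (D - birkhoff k (f u)) * 1"
    using dist le1 by (intro mult_mono) auto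
  finally show "\<bar>f u - u\<bar> \<le> exp (\<eta> * (ln (real k) + 1) + M - birkhoff k (f u))"
    by (simp add: D_def)
  have "\<bar>(f ^^ k) (f u) - (f ^^ k) u\<bar> \<le> exp (D + birkhoff k (f u)) * 1"
    unfolding \<xi>(2) using dist le1 by (intro mult_mono) auto
  then show "\<bar>(f ^^ k) (f u) - (f ^^ k) u\<bar> \<le> exp (\<eta> * (ln (real k) + 1) + M + birkhoff k (f u))"
    by (simp add: D_def)
qed

text \<open>
  The factor \<open>1 - \<delta>\<close> on \<open>a\<close> has to stay, but on the distortion bound it can be dropped, since that
  bound is nonnegative.
\<close>
lemma log_modulus_exp_le:
  assumes "0 < \<delta>" "\<delta> < 1" "0 < k" "0 \<le> t" "t \<le> 1" "t \<le> exp (\<eta> * (ln (real k) + 1) + M - a)"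
  shows "log_modulus \<eta> M t
           \<le> (\<eta> / \<delta> + M) * exp (\<eta> + M) * real k powr \<eta> * exp (- (1 - \<delta>) * a)"
proof -
  define D where "D = \<eta> * (ln (real k) + 1) + M"
  have D: "D \<ge> 0" using assms eta_nonneg M_nonneg by (simp add: D_def)
  have "log_modulus \<eta> M t \<le> (\<eta> / \<delta> + M) * t powr (1 - \<delta>)"
    using assms eta_nonneg M_nonneg by (intro log_modulus_le_powr) auto
  also have "t powr (1 - \<delta>) \<le> exp (D - a) powr (1 - \<delta>)"
    using assms by (intro powr_mono2) (auto simp: D_def)
  also have "exp (D - a) powr (1 - \<delta>) = exp ((1 - \<delta>) * (D - a))"
    by (simp add: powr_def)
  also have "\<dots> \<le> exp (D - (1 - \<delta>) * a)"
    using D assms by (simp add: algebra_simps)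
  also have "\<dots> = exp (\<eta> + M) * real k powr \<eta> * exp (- (1 - \<delta>) * a)"
    using assms by (simp add: D_def powr_def algebra_simps flip: exp_add)
  finally show ?thesis
    using assms eta_nonneg M_nonneg by (simp add: mult_left_mono mult.assoc)
qed

text \<open>
  Let \<open>x = f u\<close> be a point where the extremum for \<open>f\<^sup>k\<close> is attained. For the maximum, the orbit
  segment is prolonged or cut at its beginning, where the fundamental interval is short because \<open>f\<^sup>k\<close>
  expands it; for the minimum, at its end, where the image is short because \<open>f\<^sup>k\<close> contracts it. In
  both cases, the second difference is at most an increment of \<open>F\<close> over that short interval.
\<close>
lemma extremum_second_difference:
  assumes \<sigma>: "\<sigma> = 1 \<or> \<sigma> = -1" and \<delta>: "0 < \<delta>" "\<delta> < 1"
  shows "2 * extremum \<sigma> (Suc k) - extremum \<sigma> k - extremum \<sigma> (Suc (Suc k))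
           \<le> (\<eta> / \<delta> + M) * exp (\<eta> + M) * real (Suc k) powr \<eta>
               * exp (- (1 - \<delta>) * extremum \<sigma> (Suc k))"
proof -
  obtain x where x: "x \<in> {0..1}" "extremum \<sigma> (Suc k) = \<sigma> * birkhoff (Suc k) x"
    by (meson extremum_attained)
  then obtain u where u: "u \<in> {0..1}" "x = f u" using onto by (metis imageE)
  have fx: "f x \<in> {0..1}" using maps[OF x(1)] .
  show ?thesis using \<sigma>
  proof
    assume [simp]: "\<sigma> = 1"
    have "birkhoff k (f x) \<le> extremum \<sigma> k" "birkhoff (Suc (Suc k)) u \<le> extremum \<sigma> (Suc (Suc k))"
      using extremum_upper[OF fx, of 1 k] extremum_upper[OF u(1), of 1 "Suc (Suc k)"] by auto
    moreover have "birkhoff (Suc k) x = F x + birkhoff k (f x)"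
      using birkhoff_add[of 1 k x] by (simp add: birkhoff_def)
    moreover have "birkhoff (Suc (Suc k)) u = F u + birkhoff (Suc k) x"
      using birkhoff_add[of 1 "Suc k" u] u(2) by (simp add: birkhoff_def)
    ultimately have "2 * extremum \<sigma> (Suc k) - extremum \<sigma> k - extremum \<sigma> (Suc (Suc k)) \<le> F x - F u"
      using x(2) by simp
    also have "\<dots> \<le> \<bar>F (f u) - F u\<bar>" using u(2) by simp
    also have "\<dots> \<le> log_modulus \<eta> M \<bar>f u - u\<bar>"
      using u x by (intro modulus) auto
    also have "\<dots> \<le> (\<eta> / \<delta> + M) * exp (\<eta> + M) * real (Suc k) powr \<eta>
                      * exp (- (1 - \<delta>) * extremum \<sigma> (Suc k))"
      using \<delta> u x fundamental_length_comparison(1)[OF u(1), of "Suc k"]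
      by (intro log_modulus_exp_le) auto
    finally show ?thesis .
  next
    assume [simp]: "\<sigma> = -1"
    have "- birkhoff k x \<le> extremum \<sigma> k" "- birkhoff (Suc (Suc k)) x \<le> extremum \<sigma> (Suc (Suc k))"
      using extremum_upper[OF x(1), of "-1" k] extremum_upper[OF x(1), of "-1" "Suc (Suc k)"]
      by auto
    moreover have "birkhoff (Suc k) x = birkhoff k x + F ((f ^^ Suc k) u)"
      using u(2) by (simp add: birkhoff_def funpow_swap1)
    moreover have "birkhoff (Suc (Suc k)) x = birkhoff (Suc k) x + F ((f ^^ Suc k) (f u))"
      using u(2) by (simp add: birkhoff_def)
    ultimately have diff: "2 * extremum \<sigma> (Suc k) - extremum \<sigma> k - extremum \<sigma> (Suc (Suc k))
        \<le> \<bar>F ((f ^^ Suc k) (f u)) - F ((f ^^ Suc k) u)\<bar>"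
      using x(2) by simp
    have in01: "(f ^^ Suc k) (f u) \<in> {0..1}" "(f ^^ Suc k) u \<in> {0..1}"
      using iterate_mem[OF u(1), of "Suc k"] iterate_mem[OF x(1), of "Suc k"] u(2) by metis+
    then have le1: "\<bar>(f ^^ Suc k) (f u) - (f ^^ Suc k) u\<bar> \<le> 1" by auto
    note diff
    also have "\<bar>F ((f ^^ Suc k) (f u)) - F ((f ^^ Suc k) u)\<bar>
        \<le> log_modulus \<eta> M \<bar>(f ^^ Suc k) (f u) - (f ^^ Suc k) u\<bar>"
      using in01 le1 by (intro modulus) auto
    also have "\<dots> \<le> (\<eta> / \<delta> + M) * exp (\<eta> + M) * real (Suc k) powr \<eta>
                      * exp (- (1 - \<delta>) * extremum \<sigma> (Suc k))"
      using \<delta> u x le1 fundamental_length_comparison(2)[OF u(1), of "Suc k"]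
      by (intro log_modulus_exp_le) (auto simp del: funpow.simps)
    finally show ?thesis .
  qed
qed

lemma extremum_le_ln:
  assumes \<sigma>: "\<sigma> = 1 \<or> \<sigma> = -1" and \<delta>: "0 < \<delta>" "\<delta> < 1"
    and sublinear: "\<And>s. s > 0 \<Longrightarrow> \<forall>\<^sub>F k in sequentially. extremum \<sigma> k \<le> s * real k"
  shows "\<exists>B\<ge>0. \<forall>k. extremum \<sigma> k \<le> (\<eta> + 2) / (1 - \<delta>) * ln (real k + 1) + B"
proof (rule sublinear_almost_convex_le_ln[OF eta_nonneg _ _ _ extremum_second_difference[OF \<sigma> \<delta>]])
qed (use \<delta> eta_nonneg M_nonneg sublinear in \<open>auto simp: extremum_0\<close>)

end

section \<open>Growth sequences of diffeomorphisms of the interval\<close>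

lemma deriv01_eqI:
  assumes "x \<in> {0..1}" "(f has_real_derivative d) (at x within {0..1})"
  shows "deriv01 f x = d"
  unfolding deriv01_def using assms
  by (intro vector_derivative_within_closed_interval)
    (auto simp: has_real_derivative_iff_has_vector_derivative)

lemma C1_on01_has_deriv01:
  assumes "C1_on01 f" "x \<in> {0..1}"
  shows "(f has_real_derivative deriv01 f x) (at x within {0..1})"
  using assms unfolding C1_on01_def differentiable_on_def deriv01_def
  by (simp add: has_real_derivative_iff_has_vector_derivative vector_derivative_works)

lemma Diff0_inverse:
  assumes "f \<in> Diff0" "x \<in> {0..1}"
  shows "inverse01 f (f x) = x"
  using assms unfolding Diff0_def inverse01_def
  by (auto simp: bij_betw_def inv_into_f_f)

lemma Diff0_image: "f \<in> Diff0 \<Longrightarrow> f ` {0..1} = {0..1}"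
  by (auto simp: Diff0_def bij_betw_def)

lemma Diff0_deriv_inverse:
  assumes f: "f \<in> Diff0" and x: "x \<in> {0..1}"
  shows "deriv01 (inverse01 f) (f x) * deriv01 f x = 1"
proof -
  have fx: "f x \<in> {0..1}" using Diff0_image[OF f] x by blast
  have "(inverse01 f has_real_derivative deriv01 (inverse01 f) (f x)) (at (f x) within f ` {0..1})"
    using f fx by (simp add: Diff0_image) (auto simp: Diff0_def intro: C1_on01_has_deriv01)
  moreover have "(f has_real_derivative deriv01 f x) (at x within {0..1})"
    using f x by (auto simp: Diff0_def intro: C1_on01_has_deriv01)
  ultimately have "(inverse01 f \<circ> f has_real_derivative deriv01 (inverse01 f) (f x) * deriv01 f x)
      (at x within {0..1})"
    by (rule DERIV_image_chain)
  then have "deriv01 (inverse01 f \<circ> f) x = deriv01 (inverse01 f) (f x) * deriv01 f x"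
    by (rule deriv01_eqI[OF x])
  moreover have "((\<lambda>x. x) has_real_derivative 1) (at x within {0..1})" by simp
  then have "(inverse01 f \<circ> f has_real_derivative 1) (at x within {0..1})"
    using x by (rule has_field_derivative_transform_within[OF _ zero_less_one])
      (simp add: Diff0_inverse[OF f])
  then have "deriv01 (inverse01 f \<circ> f) x = 1" by (rule deriv01_eqI[OF x])
  ultimately show ?thesis by simp
qed

text \<open>
  The derivative has no zeros, by the chain rule for the inverse, and takes the value \<open>1\<close>
  somewhere, since \<open>f 1 - f 0 = 1\<close>. By continuity it does not change sign.
\<close>
lemma Diff0_deriv_pos:
  assumes f: "f \<in> Diff0" and x: "x \<in> {0..1}"
  shows "deriv01 f x > 0"
proof (rule ccontr)
  assume "\<not> deriv01 f x > 0"
  have C1: "C1_on01 f" and f01: "f 0 = 0" "f 1 = 1" using f by (auto simp: Diff0_def)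
  have "\<exists>\<xi>\<in>{0<..<1}. f 1 - f 0 = deriv01 f \<xi> * (1 - 0)"
  proof (rule mvt_simple)
    fix x :: real assume "0 \<le> x" "x \<le> 1"
    then show "(f has_derivative (*) (deriv01 f x)) (at x within {0..1})"
      using C1_on01_has_deriv01[OF C1, of x] by (simp add: has_field_derivative_def)
  qed simp
  then obtain \<xi> where "\<xi> \<in> {0<..<1}" "f 1 - f 0 = deriv01 f \<xi> * (1 - 0)" by blast
  then have \<xi>: "\<xi> \<in> {0..1}" "deriv01 f \<xi> = 1" using f01 by auto
  have "connected (deriv01 f ` {0..1})"
    using C1 by (intro connected_continuous_image) (auto simp: C1_on01_def)
  then have "is_interval (deriv01 f ` {0..1})" by (simp add: is_interval_connected_1)
  moreover have "deriv01 f x \<in> deriv01 f ` {0..1}" "1 \<in> deriv01 f ` {0..1}"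
    using x \<xi> by (auto simp: image_iff)
  ultimately have "0 \<in> deriv01 f ` {0..1}"
    using \<open>\<not> deriv01 f x > 0\<close> unfolding is_interval_1 by (meson not_less zero_le_one)
  then obtain z where "z \<in> {0..1}" "deriv01 f z = 0" by auto
  then show False using Diff0_deriv_inverse[OF f, of z] by simp
qed

lemma Diff0_interval_dynamics:
  assumes f: "f \<in> Diff0"
  shows "interval_dynamics f (\<lambda>x. ln (deriv01 f x))"
proof
  show "f ` {0..1} = {0..1}" using Diff0_image[OF f] .
  have C1: "C1_on01 f" using f by (simp add: Diff0_def)
  show "(f has_real_derivative exp (ln (deriv01 f x))) (at x within {0..1})" if "x \<in> {0..1}" for x
    using C1_on01_has_deriv01[OF C1 that] Diff0_deriv_pos[OF f that] by simp
  show "continuous_on {0..1} (\<lambda>x. ln (deriv01 f x))"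
    using C1 Diff0_deriv_pos[OF f]
    by (intro continuous_on_ln) (fastforce simp: C1_on01_def)+
qed

context
  fixes f F :: "real \<Rightarrow> real"
  assumes f: "f \<in> Diff0"
  defines "F \<equiv> \<lambda>x. ln (deriv01 f x)"
begin

interpretation interval_dynamics f F
  unfolding F_def by (rule Diff0_interval_dynamics[OF f])

lemma sup_norm01_exp_extremum:
  assumes "\<And>y. y \<in> {0..1} \<Longrightarrow> \<exists>x\<in>{0..1}. g y = exp (\<sigma> * birkhoff n x)"
    and "\<And>x. x \<in> {0..1} \<Longrightarrow> \<exists>y\<in>{0..1}. g y = exp (\<sigma> * birkhoff n x)"
  shows "sup_norm01 g = exp (extremum \<sigma> n)"
  unfolding sup_norm01_def
proof (rule cSup_eq_maximum)
  obtain x where x: "x \<in> {0..1}" "extremum \<sigma> n = \<sigma> * birkhoff n x"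
    by (meson extremum_attained)
  then obtain y where "y \<in> {0..1}" "g y = exp (\<sigma> * birkhoff n x)" using assms(2) by blast
  then show "exp (extremum \<sigma> n) \<in> (\<lambda>y. \<bar>g y\<bar>) ` {0..1}" using x by (intro image_eqI[of _ _ y]) auto
next
  fix v assume "v \<in> (\<lambda>y. \<bar>g y\<bar>) ` {0..1}"
  then obtain x where "x \<in> {0..1}" "v = exp (\<sigma> * birkhoff n x)" using assms(1) by fastforce
  then show "v \<le> exp (extremum \<sigma> n)" using extremum_upper by simp
qed

lemma ln_growth_seq: "ln (growth_seq f n) = max (extremum 1 n) (extremum (-1) n)"
proof -
  have "deriv01 (f ^^ n) x = exp (1 * birkhoff n x)" if "x \<in> {0..1}" for x
    using deriv01_eqI[OF that iterate_deriv[OF that]] by simp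
  then have 1: "sup_norm01 (deriv01 (f ^^ n)) = exp (extremum 1 n)"
    by (intro sup_norm01_exp_extremum) blast+
  have g: "(inverse01 f has_real_derivative exp (- F x)) (at (f x) within {0..1})"
    if x: "x \<in> {0..1}" for x
  proof -
    have "exp (- F x) = deriv01 (inverse01 f) (f x)"
      using Diff0_deriv_inverse[OF f x] Diff0_deriv_pos[OF f x]
      by (simp add: F_def exp_minus field_simps)
    moreover have "(inverse01 f has_real_derivative deriv01 (inverse01 f) (f x))
        (at (f x) within {0..1})"
      using f maps[OF x] by (auto simp: Diff0_def intro: C1_on01_has_deriv01)
    ultimately show ?thesis by simp
  qed
  have "deriv01 (inverse01 f ^^ n) ((f ^^ n) x) = exp (- 1 * birkhoff n x)" if "x \<in> {0..1}" for x
    using deriv01_eqI[OF iterate_mem[OF that] iterate_inverse_deriv[OF Diff0_inverse[OF f] g that]]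
    by simp
  then have 2: "sup_norm01 (deriv01 (inverse01 f ^^ n)) = exp (extremum (-1) n)"
    using iterate_mem iterate_onto[of n] by (intro sup_norm01_exp_extremum) (metis imageE, metis)
  show ?thesis unfolding growth_seq_def 1 2 by (simp add: max_def)
qed

lemma growth_seq_pos: "growth_seq f n > 0"
proof -
  have "sup_norm01 (deriv01 (f ^^ n)) = exp (extremum 1 n)"
    using deriv01_eqI[OF _ iterate_deriv] by (intro sup_norm01_exp_extremum) auto
  then show ?thesis by (simp add: growth_seq_def less_max_iff_disj)
qed

text \<open>
  \<open>ln \<Gamma>\<^sub>n\<close> is a nonnegative subadditive sequence, so \<open>ln \<Gamma>\<^sub>n / n\<close> converges to some \<open>l\<close>, and the growth rate
  is \<open>exp l\<close>.
\<close>
lemma extremum_sublinear: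
  assumes rate: "growth_rate f = 1" and \<sigma>: "\<sigma> = 1 \<or> \<sigma> = -1" and s: "s > 0"
  shows "\<forall>\<^sub>F n in sequentially. extremum \<sigma> n \<le> s * real n"
proof -
  define u where "u n = ln (growth_seq f n)" for n
  have u: "u n = max (extremum 1 n) (extremum (-1) n)" for n
    by (simp add: u_def ln_growth_seq)
  have "u (m + n) \<le> u m + u n" for m n
    using extremum_subadditive[of 1 m n] extremum_subadditive[of "-1" m n] unfolding u by linarith
  moreover have "0 \<le> u n" for n
    using extremum_upper[of 0 1 n] extremum_upper[of 0 "-1" n] by (simp add: u le_max_iff_disj) linarith
  ultimately obtain l where l: "(\<lambda>n. u n / real n) \<longlonglongrightarrow> l"
    using subadditive_convergent_average[of u] by (auto simp: convergent_def)
  have "\<forall>\<^sub>F n in sequentially. exp (u n / real n) = root n (growth_seq f n)"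
    using eventually_gt_at_top[of 0]
  proof eventually_elim
    case (elim n)
    have "root n (growth_seq f n) = root n (exp (u n / real n) ^ n)"
      using elim growth_seq_pos[of n] by (simp add: u_def flip: exp_of_nat_mult)
    then show ?case using elim by (simp add: real_root_pos2)
  qed
  moreover have "(\<lambda>n. exp (u n / real n)) \<longlonglongrightarrow> exp l" by (intro tendsto_exp l)
  ultimately have "(\<lambda>n. root n (growth_seq f n)) \<longlonglongrightarrow> exp l"
    by (simp add: tendsto_cong)
  then have "exp l = 1" using rate by (simp add: growth_rate_def limI)
  then have "(\<lambda>n. u n / real n) \<longlonglongrightarrow> 0" using l by simp
  then have "\<forall>\<^sub>F n in sequentially. u n / real n < s" using s by (rule order_tendstoD)
  then show ?thesis using eventually_gt_at_top[of 0]
  proof eventually_elim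
    case (elim n)
    then have "u n \<le> s * real n" by (simp add: field_simps)
    then show ?case using \<sigma> by (auto simp: u)
  qed
qed

end

section \<open>Moduli of continuity\<close>

lemma modulus_of_continuity_bounds:
  assumes "modulus_of_continuity \<omega>" "t \<in> {0..1}"
  shows "0 \<le> \<omega> t" "\<omega> t \<le> \<omega> 1"
  using assms unfolding modulus_of_continuity_def mono_on_def by auto

text \<open>
  Covering \<open>[0,1]\<close> by at most \<open>2 / x\<close> intervals of a common length \<open>1 / m \<le> x\<close>, subadditivity gives
  \<open>\<omega> 1 \<le> m \<omega> (1 / m) \<le> (2 / x) \<omega> x\<close>.
\<close>
lemma modulus_of_continuity_ge_linear:
  assumes \<omega>: "modulus_of_continuity \<omega>" and x: "x \<in> {0..1}"
  shows "\<omega> 1 / 2 * x \<le> \<omega> x"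
proof (cases "x = 0")
  case True
  then show ?thesis using \<omega> by (simp add: modulus_of_continuity_def)
next
  case False
  then have x0: "0 < x" "x \<le> 1" using x by auto
  define m where "m = nat \<lceil>1 / x\<rceil>"
  have m1: "1 / x \<le> real m" "real m < 1 / x + 1" using x0 unfolding m_def by (simp, simp) linarith
  have m: "m > 0" using x0 by (simp add: m_def)
  with m1 have m2: "1 / real m \<le> x" "real m * x \<le> 2"
    using x0 by (simp_all add: field_simps)
  have mult: "real j * (1 / real m) \<le> 1 \<Longrightarrow> \<omega> (real j * (1 / real m)) \<le> real j * \<omega> (1 / real m)" for j
  proof (induction j)
    case 0
    then show ?case using \<omega> by (simp add: modulus_of_continuity_def)
  next
    case (Suc j)
    have sub: "\<omega> (a + b) \<le> \<omega> a + \<omega> b" if "0 \<le> a" "0 \<le> b" "a + b \<le> 1" for a b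
      using \<omega> that unfolding modulus_of_continuity_def by auto
    have "\<omega> (real j * (1 / real m) + 1 / real m) \<le> \<omega> (real j * (1 / real m)) + \<omega> (1 / real m)"
      using Suc.prems by (intro sub) (auto simp: algebra_simps add_divide_distrib)
    moreover have "real j * (1 / real m) \<le> real (Suc j) * (1 / real m)"
      by (intro mult_right_mono) auto
    then have "real j * (1 / real m) \<le> 1" using Suc.prems by (rule order.trans)
    ultimately show ?case using Suc.IH by (simp add: algebra_simps add_divide_distrib)
  qed
  have "\<omega> 1 \<le> real m * \<omega> (1 / real m)" using mult[of m] m by simp
  also have "\<dots> \<le> real m * \<omega> x"
    using \<omega> m m2 x unfolding modulus_of_continuity_def mono_on_def
    by (intro mult_left_mono) auto
  finally have "\<omega> 1 * x \<le> real m * \<omega> x * x" using x0 by (intro mult_right_mono) auto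
  also have "\<dots> = real m * x * \<omega> x" by simp
  also have "\<dots> \<le> 2 * \<omega> x"
    using m2 modulus_of_continuity_bounds(1)[OF \<omega> x] by (intro mult_right_mono) auto
  finally show ?thesis by simp
qed

text \<open>
  The bound near \<open>0\<close> is assumed; away from \<open>0\<close> the bounded function \<open>\<omega>\<close> is absorbed by the linear term.
\<close>
lemma modulus_of_continuity_le_log_modulus:
  assumes \<omega>: "modulus_of_continuity \<omega>" and \<eta>: "0 \<le> \<eta>"
    and ev: "\<forall>\<^sub>F x in at_right 0. \<omega> x / (x * ln (exp 1 / x)) \<le> \<eta>"
  shows "\<exists>M\<ge>0. \<forall>t\<in>{0..1}. \<omega> t \<le> log_modulus \<eta> M t"
proof -
  from ev obtain r where r: "r > 0" "\<And>x. 0 < x \<Longrightarrow> x < r \<Longrightarrow> \<omega> x / (x * ln (exp 1 / x)) \<le> \<eta>"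
    by (auto simp: eventually_at_right_field)
  define M where "M = \<omega> 1 / r"
  have M: "M \<ge> 0" using r modulus_of_continuity_bounds(1)[OF \<omega>, of 1] by (simp add: M_def)
  have "\<omega> t \<le> log_modulus \<eta> M t" if t: "t \<in> {0..1}" for t
  proof (cases "t = 0")
    case True
    then show ?thesis using \<omega> by (simp add: modulus_of_continuity_def log_modulus_def)
  next
    case False
    then have t0: "0 < t" "t \<le> 1" using t by auto
    have ln: "ln (exp 1 / t) > 0" using t0 ln_le_zero_iff[of t] by (simp add: ln_div del: ln_le_zero_iff)
    show ?thesis
    proof (cases "t < r")
      case True
      have "\<omega> t \<le> \<eta> * (t * ln (exp 1 / t))"
        using r(2)[OF t0(1) True] t0 ln by (simp add: pos_divide_le_eq)
      moreover have "0 \<le> M * t" using M t0 by simp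
      ultimately show ?thesis unfolding log_modulus_def by linarith
    next
      case False
      have "\<omega> t \<le> \<omega> 1 * 1" using modulus_of_continuity_bounds(2)[OF \<omega> t] by simp
      also have "\<dots> \<le> \<omega> 1 * (t / r)"
        using False r modulus_of_continuity_bounds(1)[OF \<omega>, of 1] by (intro mult_left_mono) auto
      finally have "\<omega> t \<le> M * t" by (simp add: M_def)
      moreover have "0 \<le> \<eta> * (t * ln (exp 1 / t))" using \<eta> t0 ln by simp
      ultimately show ?thesis by (simp add: log_modulus_def)
    qed
  qed
  with M show ?thesis by blast
qed

text \<open>
  The derivative is bounded away from \<open>0\<close>, where the logarithm is Lipschitz, so \<open>ln f'\<close> inherits the
  modulus of continuity of \<open>f'\<close>.
\<close>
lemma Diff0_mod_ln_deriv_modulus: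
  assumes \<omega>: "modulus_of_continuity \<omega>" and f: "f \<in> Diff0_mod \<omega>"
  shows "\<exists>K\<ge>0. \<forall>x\<in>{0..1}. \<forall>y\<in>{0..1}. \<forall>t\<le>1. \<bar>x - y\<bar> \<le> t \<longrightarrow>
           \<bar>ln (deriv01 f x) - ln (deriv01 f y)\<bar> \<le> K * \<omega> t"
proof -
  have f0: "f \<in> Diff0" using f by (simp add: Diff0_mod_def)
  then have cont: "continuous_on {0..1} (deriv01 f)" by (simp add: Diff0_def C1_on01_def)
  obtain K where K: "\<And>\<delta>. \<delta> \<in> {0..1} \<Longrightarrow> oscillation01 (deriv01 f) \<delta> \<le> K * \<omega> \<delta>"
    using f unfolding Diff0_mod_def by blast
  obtain z where z: "z \<in> {0..1}" "\<And>x. x \<in> {0..1} \<Longrightarrow> deriv01 f z \<le> deriv01 f x"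
    using continuous_attains_inf[OF _ _ cont] by auto
  obtain w where w: "\<And>x. x \<in> {0..1} \<Longrightarrow> deriv01 f x \<le> deriv01 f w"
    using continuous_attains_sup[OF _ _ cont] by fastforce
  define c where "c = deriv01 f z"
  have c: "c > 0" unfolding c_def using Diff0_deriv_pos[OF f0 z(1)] .
  have osc: "\<bar>deriv01 f x - deriv01 f y\<bar> \<le> \<bar>K\<bar> * \<omega> t"
    if xy: "x \<in> {0..1}" "y \<in> {0..1}" "\<bar>x - y\<bar> \<le> t" "t \<le> 1" for x y t
  proof -
    let ?P = "{(x, y). x \<in> {0..1} \<and> y \<in> {0..1} \<and> \<bar>x - y\<bar> \<le> t}"
    have t: "t \<in> {0..1}" using xy by auto
    have "bdd_above ((\<lambda>(x, y). \<bar>deriv01 f x - deriv01 f y\<bar>) ` ?P)"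
    proof (rule bdd_aboveI)
      fix v assume "v \<in> (\<lambda>(x, y). \<bar>deriv01 f x - deriv01 f y\<bar>) ` ?P"
      then obtain x y where v: "x \<in> {0..1}" "y \<in> {0..1}" "v = \<bar>deriv01 f x - deriv01 f y\<bar>" by auto
      show "v \<le> deriv01 f w - c"
        using z(2)[OF v(1)] z(2)[OF v(2)] w[OF v(1)] w[OF v(2)] v(3) by (simp add: c_def)
    qed
    then have "(\<lambda>(x, y). \<bar>deriv01 f x - deriv01 f y\<bar>) (x, y) \<le> oscillation01 (deriv01 f) t"
      unfolding oscillation01_def using xy by (intro cSUP_upper) auto
    also have "\<dots> \<le> K * \<omega> t" using K[OF t] .
    also have "\<dots> \<le> \<bar>K\<bar> * \<omega> t"
      using modulus_of_continuity_bounds(1)[OF \<omega> t] by (intro mult_right_mono) auto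
    finally show ?thesis by simp
  qed
  have ln_diff: "ln (deriv01 f x) - ln (deriv01 f y) \<le> \<bar>deriv01 f x - deriv01 f y\<bar> / c"
    if "x \<in> {0..1}" "y \<in> {0..1}" for x y
  proof -
    let ?a = "deriv01 f x" and ?b = "deriv01 f y"
    have ab: "?a > 0" "?b \<ge> c" "?b > 0"
      using that Diff0_deriv_pos[OF f0] z(2) by (auto simp: c_def)
    have "ln ?a - ln ?b \<le> ?a / ?b - 1"
      using ab ln_le_minus_one[of "?a / ?b"] by (simp add: ln_div)
    also have "\<dots> = (?a - ?b) / ?b" using ab by (simp add: diff_divide_distrib)
    also have "\<dots> \<le> \<bar>?a - ?b\<bar> / ?b" using ab by (intro divide_right_mono) auto
    also have "\<dots> \<le> \<bar>?a - ?b\<bar> / c" using ab c by (intro divide_left_mono) auto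
    finally show ?thesis .
  qed
  have "\<bar>ln (deriv01 f x) - ln (deriv01 f y)\<bar> \<le> \<bar>K\<bar> / c * \<omega> t"
    if xy: "x \<in> {0..1}" "y \<in> {0..1}" "\<bar>x - y\<bar> \<le> t" "t \<le> 1" for x y t
  proof -
    have "\<bar>ln (deriv01 f x) - ln (deriv01 f y)\<bar> \<le> \<bar>deriv01 f x - deriv01 f y\<bar> / c"
      using ln_diff[OF xy(1,2)] ln_diff[OF xy(2,1)] by (simp add: abs_minus_commute abs_le_iff)
    also have "\<dots> \<le> \<bar>K\<bar> * \<omega> t / c" using osc[OF xy] c by (intro divide_right_mono) auto
    finally show ?thesis by simp
  qed
  then show ?thesis using c by (intro exI[of _ "\<bar>K\<bar> / c"]) auto
qed

section \<open>Logarithmic growth\<close>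

text \<open>
  The constant \<open>K\<close> must not depend on \<open>\<eta>\<close> and \<open>\<delta>\<close>: only then does the factor in front of the logarithm
  tend to \<open>2\<close> as \<open>\<eta>\<close> and \<open>\<delta>\<close> tend to \<open>0\<close>.
\<close>
lemma ln_growth_seq_le_ln:
  assumes \<omega>: "modulus_of_continuity \<omega>" and f: "f \<in> Diff0_mod \<omega>" and rate: "growth_rate f = 1"
  shows "\<exists>K\<ge>0. \<forall>\<eta>\<ge>0. \<forall>\<delta>. 0 < \<delta> \<longrightarrow> \<delta> < 1 \<longrightarrow>
           (\<forall>\<^sub>F x in at_right 0. \<omega> x / (x * ln (exp 1 / x)) \<le> \<eta>) \<longrightarrow>
           (\<exists>B\<ge>0. \<forall>n. ln (growth_seq f n) \<le> (K * \<eta> + 2) / (1 - \<delta>) * ln (real n + 1) + B)"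
proof -
  have f0: "f \<in> Diff0" using f by (simp add: Diff0_mod_def)
  obtain K where K: "K \<ge> 0" "\<And>x y t. \<lbrakk>x \<in> {0..1}; y \<in> {0..1}; t \<le> 1; \<bar>x - y\<bar> \<le> t\<rbrakk>
      \<Longrightarrow> \<bar>ln (deriv01 f x) - ln (deriv01 f y)\<bar> \<le> K * \<omega> t"
    using Diff0_mod_ln_deriv_modulus[OF \<omega> f] by blast
  have "\<exists>B\<ge>0. \<forall>n. ln (growth_seq f n) \<le> (K * \<eta> + 2) / (1 - \<delta>) * ln (real n + 1) + B"
    if \<eta>: "\<eta> \<ge> 0" and \<delta>: "0 < \<delta>" "\<delta> < 1"
      and ev: "\<forall>\<^sub>F x in at_right 0. \<omega> x / (x * ln (exp 1 / x)) \<le> \<eta>" for \<eta> \<delta>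
  proof -
    obtain M where M: "M \<ge> 0" "\<And>t. t \<in> {0..1} \<Longrightarrow> \<omega> t \<le> log_modulus \<eta> M t"
      using modulus_of_continuity_le_log_modulus[OF \<omega> \<eta> ev] by blast
    interpret interval_dynamics f "\<lambda>x. ln (deriv01 f x)"
      by (rule Diff0_interval_dynamics[OF f0])
    interpret interval_dynamics_log_modulus f "\<lambda>x. ln (deriv01 f x)" "K * \<eta>" "K * M"
    proof
      fix x y t :: real
      assume xy: "x \<in> {0..1}" "y \<in> {0..1}" "\<bar>x - y\<bar> \<le> t" "t \<le> 1"
      have "\<bar>ln (deriv01 f x) - ln (deriv01 f y)\<bar> \<le> K * \<omega> t" using K(2) xy by blast
      also have "\<dots> \<le> K * log_modulus \<eta> M t" using K(1) M(2)[of t] xy by (intro mult_left_mono) auto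
      also have "\<dots> = log_modulus (K * \<eta>) (K * M) t" by (simp add: log_modulus_def algebra_simps)
      finally show "\<bar>ln (deriv01 f x) - ln (deriv01 f y)\<bar> \<le> log_modulus (K * \<eta>) (K * M) t" .
    qed (use K M \<eta> in auto)
    obtain B1 where B1: "B1 \<ge> 0"
      "\<And>n. extremum 1 n \<le> (K * \<eta> + 2) / (1 - \<delta>) * ln (real n + 1) + B1"
      using extremum_le_ln[OF _ \<delta> extremum_sublinear[OF f0 rate], of 1] by auto
    obtain B2 where B2: "B2 \<ge> 0"
      "\<And>n. extremum (-1) n \<le> (K * \<eta> + 2) / (1 - \<delta>) * ln (real n + 1) + B2"
      using extremum_le_ln[OF _ \<delta> extremum_sublinear[OF f0 rate], of "-1"] by auto
    have "ln (growth_seq f n) \<le> (K * \<eta> + 2) / (1 - \<delta>) * ln (real n + 1) + max B1 B2" for n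
      using B1(2)[of n] B2(2)[of n] unfolding ln_growth_seq[OF f0] by linarith
    then show ?thesis using B1(1) by (intro exI[of _ "max B1 B2"]) auto
  qed
  then show ?thesis using K(1) by (intro exI[of _ K]) blast
qed

lemma ln_Suc_le:
  assumes "n \<ge> 1"
  shows "ln (real n + 1) \<le> ln (real n) + ln 2"
proof -
  have "ln (real n + 1) \<le> ln (2 * real n)" using assms by (intro ln_mono) auto
  then show ?thesis using assms by (simp add: ln_mult)
qed

text \<open>
  It remains to compare \<open>ln n\<close> with \<open>L n = ln (n / \<omega>\<^sup>-\<^sup>1 (2/n))\<close>: the first claim uses \<open>L n \<ge> ln n\<close>, the
  second one \<open>L n \<ge> 2 ln n - C\<close>.
\<close>
theorem corollary1:
  fixes \<omega> f :: "real \<Rightarrow> real"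
  assumes "modulus_of_continuity \<omega>"
    and "strict_mono_on {0..1} \<omega>"
    and "f \<in> Diff0_mod \<omega>"
    and "growth_rate f = 1"
  shows "(Limsup (at_right 0) (\<lambda>x. ereal (\<omega> x / (x * ln (exp 1 / x)))) < \<infinity> \<longrightarrow>
           (\<exists>C. \<forall>n\<ge>2. 2 / real n \<in> \<omega> ` {0..1} \<longrightarrow>
              ln (growth_seq f n) \<le> C * ln (real n / inv_into {0..1} \<omega> (2 / real n))))
       \<and> (((\<lambda>x. \<omega> x / (x * ln (exp 1 / x))) \<longlongrightarrow> 0) (at_right 0) \<longrightarrow>
           (\<exists>\<epsilon> :: nat \<Rightarrow> real. \<epsilon> \<longlonglongrightarrow> 0 \<and>
              (\<forall>\<^sub>F n in sequentially.
                 ln (growth_seq f n)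
                   \<le> (1 + \<epsilon> n) * ln (real n / inv_into {0..1} \<omega> (2 / real n)))))"
proof -
  note \<omega> = assms(1) and incr = assms(2)
  define R where "R x = \<omega> x / (x * ln (exp 1 / x))" for x
  define y where "y n = inv_into {0..1} \<omega> (2 / real n)" for n
  define L where "L n = ln (real n / y n)" for n
  have \<omega>0: "\<omega> 0 = 0" using \<omega> by (simp add: modulus_of_continuity_def)
  have \<omega>1: "\<omega> 1 > 0" using incr \<omega>0 by (auto simp: strict_mono_on_def dest: spec[of _ 0])
  have y: "0 < y n" "y n \<le> 1" "\<omega> (y n) = 2 / real n"
    if "n > 0" "2 / real n \<in> \<omega> ` {0..1}" for n
  proof -
    have mem: "y n \<in> {0..1}" unfolding y_def using that(2) by (rule inv_into_into)
    show eq: "\<omega> (y n) = 2 / real n" unfolding y_def using that(2) by (rule f_inv_into_f)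
    then have "y n \<noteq> 0" using \<omega>0 that(1) by auto
    then show "0 < y n" "y n \<le> 1" using mem by auto
  qed
  obtain K where K: "K \<ge> 0" "\<And>\<eta> \<delta>. \<lbrakk>0 \<le> \<eta>; 0 < \<delta>; \<delta> < 1; \<forall>\<^sub>F x in at_right 0. R x \<le> \<eta>\<rbrakk> \<Longrightarrow>
      \<exists>B\<ge>0. \<forall>n. ln (growth_seq f n) \<le> (K * \<eta> + 2) / (1 - \<delta>) * ln (real n + 1) + B"
    using ln_growth_seq_le_ln[OF assms(1,3,4)] unfolding R_def by blast
  have part1: "\<exists>C. \<forall>n\<ge>2. 2 / real n \<in> \<omega> ` {0..1} \<longrightarrow> ln (growth_seq f n) \<le> C * L n"
    if limsup: "Limsup (at_right 0) (\<lambda>x. ereal (R x)) < \<infinity>"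
  proof -
    obtain q where "Limsup (at_right 0) (\<lambda>x. ereal (R x)) < ereal q"
      using limsup less_PInf_Ex_of_nat by fastforce
    then have "\<forall>\<^sub>F x in at_right 0. ereal (R x) < ereal q" by (rule Limsup_lessD)
    then have "\<forall>\<^sub>F x in at_right 0. R x \<le> max q 0" by eventually_elim auto
    from K(2)[OF _ _ _ this, of "1 / 2"] obtain B where B: "B \<ge> 0"
      "\<And>n. ln (growth_seq f n) \<le> (K * max q 0 + 2) / (1 / 2) * ln (real n + 1) + B" by auto
    define A where "A = (K * max q 0 + 2) / (1 / 2)"
    have A: "A \<ge> 0" using K(1) by (simp add: A_def)
    have "ln (growth_seq f n) \<le> (2 * A + B / ln 2) * L n"
      if n: "n \<ge> 2" "2 / real n \<in> \<omega> ` {0..1}" for n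
    proof -
      have "real n \<le> real n / y n" using y[of n] n by (simp add: field_simps)
      then have L: "ln (real n) \<le> L n" unfolding L_def using n by (intro ln_mono) auto
      have ln2: "ln 2 \<le> ln (real n)" using n by (intro ln_mono) auto
      have "ln (growth_seq f n) \<le> A * ln (real n + 1) + B" using B(2) by (simp add: A_def)
      also have "\<dots> \<le> A * (2 * L n) + B / ln 2 * ln 2"
      proof -
        have "ln (real n + 1) \<le> 2 * L n" using L ln2 ln_Suc_le[of n] n by linarith
        then show ?thesis using A by (simp add: mult_left_mono)
      qed
      also have "\<dots> \<le> A * (2 * L n) + B / ln 2 * L n"
        using B(1) L ln2 by (intro add_left_mono mult_left_mono) auto
      finally show ?thesis by (simp add: algebra_simps)
    qed
    then show ?thesis by blast
  qed
  have part2: "\<exists>\<epsilon> :: nat \<Rightarrow> real. \<epsilon> \<longlonglongrightarrow> 0 \<and>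
      (\<forall>\<^sub>F n in sequentially. ln (growth_seq f n) \<le> (1 + \<epsilon> n) * L n)"
    if lim: "(R \<longlongrightarrow> 0) (at_right 0)"
  proof -
    define C where "C = ln (4 / \<omega> 1)"
    have "\<forall>\<^sub>F n in sequentially. 2 / real n < \<omega> 1"
      using \<omega>1 by (intro order_tendstoD(2)[OF lim_const_over_n]) auto
    then have L_ge: "\<forall>\<^sub>F n in sequentially. 2 * ln (real n) - C \<le> L n"
      using eventually_gt_at_top[of 0]
    proof eventually_elim
      case (elim n)
      have "\<exists>x\<ge>0. x \<le> 1 \<and> \<omega> x = 2 / real n"
        using \<omega> \<omega>0 elim by (intro IVT') (auto simp: modulus_of_continuity_def)
      then have "2 / real n \<in> \<omega> ` {0..1}" by (metis atLeastAtMost_iff imageI)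
      note y = y[OF elim(2) this]
      have "\<omega> 1 / 2 * y n \<le> 2 / real n"
        using modulus_of_continuity_ge_linear[OF \<omega>, of "y n"] y by simp
      then have "real n * real n / (4 / \<omega> 1) \<le> real n / y n"
        using elim y(1) \<omega>1 by (simp add: field_simps)
      then have "ln (real n * real n / (4 / \<omega> 1)) \<le> L n"
        unfolding L_def using elim \<omega>1 by (intro ln_mono) auto
      then show ?case using elim \<omega>1 by (simp add: C_def ln_div ln_mult)
    qed
    have "filterlim (\<lambda>n. - C + 2 * ln (real n)) at_top sequentially"
      by (intro filterlim_tendsto_add_at_top[OF tendsto_const]
          filterlim_tendsto_pos_mult_at_top[OF tendsto_const]
          filterlim_compose[OF ln_at_top filterlim_real_sequentially]) simp
    then have "filterlim (\<lambda>n. 2 * ln (real n) - C) at_top sequentially" by simp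
    then have L_top: "filterlim L at_top sequentially"
      using L_ge by (rule filterlim_at_top_mono)
    have le: "\<forall>\<^sub>F n in sequentially. ln (growth_seq f n) \<le> (1 + e) * L n" if e: "e > 0" for e
    proof -
      \<comment> \<open>With \<open>\<delta> = \<tau>\<close> and \<open>K \<eta> \<le> \<tau>\<close> the factor is at most \<open>2 + e\<close>. Since \<open>ln n\<close> is at most about
        \<open>L n / 2\<close>, this costs \<open>(1 + e / 2) L n\<close>, and the remaining \<open>(e / 2) L n\<close> absorbs the constants.\<close>
      define \<tau> where "\<tau> = e / (3 + e)"
      have \<tau>: "0 < \<tau>" "\<tau> < 1" using e by (auto simp: \<tau>_def)
      have ratio: "(\<tau> + 2) / (1 - \<tau>) = 2 + e"
      proof -
        have "\<tau> * (3 + e) = e" using e by (simp add: \<tau>_def)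
        then show ?thesis using \<tau> by (simp add: divide_eq_eq algebra_simps)
      qed
      have "\<forall>\<^sub>F x in at_right 0. R x < \<tau> / (K + 1)"
        using lim \<tau> K(1) by (intro order_tendstoD(2)) auto
      then have "\<forall>\<^sub>F x in at_right 0. R x \<le> \<tau> / (K + 1)" by eventually_elim simp
      from K(2)[OF _ \<tau> this] obtain B where B: "B \<ge> 0"
        "\<And>n. ln (growth_seq f n) \<le> (K * (\<tau> / (K + 1)) + 2) / (1 - \<tau>) * ln (real n + 1) + B"
        using \<tau> K(1) by auto
      define C' where "C' = (2 + e) * (C / 2 + ln 2) + B"
      from L_ge filterlim_at_top[THEN iffD1, OF L_top, rule_format, of "2 * C' / e"]
        eventually_gt_at_top[of 0]
      show ?thesis
      proof eventually_elim
        case (elim n)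
        have "K * (\<tau> / (K + 1)) \<le> \<tau>" using K(1) \<tau> by (simp add: field_simps)
        then have "(K * (\<tau> / (K + 1)) + 2) / (1 - \<tau>) \<le> 2 + e"
          unfolding ratio[symmetric] using \<tau> by (intro divide_right_mono) auto
        then have "ln (growth_seq f n) \<le> (2 + e) * ln (real n + 1) + B"
          using B(2)[of n] mult_right_mono[of "(K * (\<tau> / (K + 1)) + 2) / (1 - \<tau>)" "2 + e" "ln (real n + 1)"]
          by simp
        also have "(2 + e) * ln (real n + 1) \<le> (2 + e) * ((L n + C) / 2 + ln 2)"
        proof (rule mult_left_mono)
          have "ln (real n) \<le> (L n + C) / 2" using elim(1) by (simp add: field_simps)
          from order.trans[OF ln_Suc_le add_right_mono[OF this]] elim(3)
          show "ln (real n + 1) \<le> (L n + C) / 2 + ln 2" by simp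
        qed (use e in simp)
        also have "(2 + e) * ((L n + C) / 2 + ln 2) + B = (1 + e / 2) * L n + C'"
          by (simp add: C'_def field_simps)
        also have "C' \<le> e / 2 * L n" using elim(2) e by (simp add: field_simps)
        also have "(1 + e / 2) * L n + e / 2 * L n = (1 + e) * L n" by (simp add: field_simps)
        finally show ?case by simp
      qed
    qed
    \<comment> \<open>The smallest admissible nonnegative error, whenever \<open>L n\<close> is positive.\<close>
    define \<epsilon> where "\<epsilon> n = max 0 (ln (growth_seq f n) / L n - 1)" for n
    have L_pos: "\<forall>\<^sub>F n in sequentially. L n > 0"
      using filterlim_at_top_dense[THEN iffD1, OF L_top] by blast
    have "\<epsilon> \<longlonglongrightarrow> 0"
    proof (rule order_tendstoI)
      fix r :: real assume "r < 0"
      then show "\<forall>\<^sub>F n in sequentially. r < \<epsilon> n" by (simp add: \<epsilon>_def less_max_iff_disj)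
    next
      fix r :: real assume r: "0 < r"
      from le[of "r / 2"] r L_pos have "\<forall>\<^sub>F n in sequentially. ln (growth_seq f n) \<le> (1 + r / 2) * L n \<and> 0 < L n"
        by (simp add: eventually_conj)
      then show "\<forall>\<^sub>F n in sequentially. \<epsilon> n < r"
      proof eventually_elim
        case (elim n)
        then have "ln (growth_seq f n) / L n \<le> 1 + r / 2" by (simp add: divide_le_eq)
        then show ?case using r by (simp add: \<epsilon>_def)
      qed
    qed
    moreover have "\<forall>\<^sub>F n in sequentially. ln (growth_seq f n) \<le> (1 + \<epsilon> n) * L n"
      using L_pos
    proof eventually_elim
      case (elim n)
      have "ln (growth_seq f n) / L n \<le> 1 + \<epsilon> n" by (simp add: \<epsilon>_def)
      then show ?case using elim by (simp add: divide_le_eq)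
    qed
    ultimately show ?thesis by blast
  qed
  show ?thesis using part1 part2 unfolding L_def y_def R_def by blast
qed

end
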